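(* Let $\mathcal A$ be a $\mathcal B(\mathcal H,\mathcal K)$-valued frame sequence with lower frame bound $\alpha$, let $\mathcal B$ be a $\mu$-perturbation of $\mathcal A$ with $0<\mu<\sqrt{\alpha}$, and assume that the gap $\Delta:=\Delta(\mathcal H_{\mathcal A},\mathcal H_{\mathcal B})$ satisfies $\Delta<1$. Then $\mathcal B$ is a $\mathcal B(\mathcal H,\mathcal K)$-valued frame sequence, and for the canonical duals $\widetilde{\mathcal A}$ and $\widetilde{\mathcal B}$ of $\mathcal A$ and $\mathcal B$, respectively, we have $$\left\|T_{\widetilde{\mathcal A}}-T_{\widetilde{\mathcal B}}\right\|\le\frac{2\mu+(2\sqrt{\alpha}-\mu)\Delta}{\sqrt{\alpha}\,(\sqrt{\alpha}-\mu)}.$$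
   Context: $\mathcal H,\mathcal K$ are Hilbert spaces, $I\subset\mathbb N$ is a finite or countable index set, and $\mathfrak K:=\ell^2(I,\mathcal K)$ is the Hilbert space of square-summable $\mathcal K$-valued sequences. $\mathcal B(X,Y)$ denotes the bounded everywhere defined linear operators $X\to Y$, with the operator norm; $P_V$ is the orthogonal projection onto a closed subspace $V$. A sequence $\mathcal A=(A_i)_{i\in I}\subset\mathcal B(\mathcal H,\mathcal K)$ is a $\mathcal B(\mathcal H,\mathcal K)$-valued Bessel sequence if there is $\beta>0$ with $\sum_{i\in I}\|A_ix\|^2\le\beta\|x\|^2$ for all $x\in\mathcal H$. Put $\mathcal H_{\mathcal A}:=\overline{\operatorname{span}}\{\operatorname{ran}A_i^*: i\in I\}$ and $P_{\mathcal A}:=P_{\mathcal H_{\mathcal A}}$. The analysis operator is $T_{\mathcal A}\in\mathcal B(\mathcal H,\mathfrak K)$, $T_{\mathcal A}x=(A_ix)_{i\in I}$, and the frame operator is $S_{\mathcal A}:=T_{\mathcal A}^*T_{\mathcal A}$. $\mathcal A$ is a $\mathcal B(\mathcal H,\mathcal K)$-valued frame sequence with lower and upper frame bounds $\alpha,\beta>0$ if $\alpha\|x\|^2\le\sum_{i\in I}\|A_ix\|^2\le\beta\|x\|^2$ for all $x\in\mathcal H_{\mathcal A}$; then $S_{\mathcal A}$ maps $\mathcal H_{\mathcal A}$ into itself and $S_{\mathcal A}|\mathcal H_{\mathcal A}$ is boundedly invertible on $\mathcal H_{\mathcal A}$. The canonical dual of an operator-valued frame sequence $\mathcal A$ is $\widetilde{\mathcal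 A}:=(A_i(S_{\mathcal A}|\mathcal H_{\mathcal A})^{-1}P_{\mathcal A})_{i\in I}$; its analysis operator is $T_{\mathcal A}(S_{\mathcal A}|\mathcal H_{\mathcal A})^{-1}P_{\mathcal A}$. For $\mu>0$, a $\mathcal B(\mathcal H,\mathcal K)$-valued Bessel sequence $\mathcal B$ is a $\mu$-perturbation of the $\mathcal B(\mathcal H,\mathcal K)$-valued Bessel sequence $\mathcal A$ if $\|T_{\mathcal A}-T_{\mathcal B}\|\le\mu$. For closed subspaces $V,W$ of $\mathcal H$, $\delta(V,W):=\|(I-P_W)|V\|$ and the gap between $V$ and $W$ is $\Delta(V,W):=\max\{\delta(V,W),\delta(W,V)\}$, which equals $\|P_V-P_W\|$. *)

theory Defs
  imports "HOL-Analysis.Analysis"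
begin

section \<open>Scalars\<close>

text \<open>
  Up to isomorphism \<^typ>\<open>real\<close> and \<^typ>\<open>complex\<close> are the only members of this class, so that
  everything below covers real and complex Hilbert spaces simultaneously.
\<close>

class rc_field = real_normed_field + banach +
  fixes conjg :: "'a \<Rightarrow> 'a"
  assumes conjg_add: "conjg (a + b) = conjg a + conjg b"
    and conjg_mult: "conjg (a * b) = conjg a * conjg b"
    and conjg_conjg: "conjg (conjg a) = a"
    and mult_conjg_scaleR: "a * conjg a = (norm a)\<^sup>2 *\<^sub>R 1"

lemma mult_conjg: "a * conjg a = of_real ((norm (a :: 'a :: rc_field))\<^sup>2)"
  by (simp only: mult_conjg_scaleR of_real_def)

instantiation real :: rc_field
begin
definition conjg_real :: "real \<Rightarrow> real" where "conjg_real x = x"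
instance by standard (simp_all add: conjg_real_def power2_eq_square)
end

instantiation complex :: rc_field
begin
definition conjg_complex :: "complex \<Rightarrow> complex" where "conjg_complex = cnj"
instance
  by standard
    (simp_all add: conjg_complex_def scaleR_conv_of_real complex_norm_square[symmetric]
      del: of_real_power)
end

lemma norm_conjg: "norm (conjg a) = norm (a :: 'a :: rc_field)"
proof (cases "a = 0")
  case True
  have "conjg (0::'a) + conjg 0 = conjg 0" by (metis conjg_add add_0)
  then show ?thesis using True by simp
next
  case False
  have "norm a * norm (conjg a) = (norm a)\<^sup>2"
    by (metis mult_conjg norm_mult norm_of_real abs_power2)
  then show ?thesis using False by (simp add: power2_eq_square)
qed

lemma conjg_of_real: "conjg (of_real r) = (of_real r :: 'a :: rc_field)"
proof (cases "r = 0")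
  case True
  then show ?thesis using norm_conjg[of "0::'a"] by simp
next
  case False
  have "of_real r * conjg (of_real r) = (of_real r * of_real r :: 'a)"
    by (simp add: mult_conjg power2_eq_square)
  then show ?thesis using False by simp
qed

lemma bounded_linear_conjg: "bounded_linear (conjg :: 'a :: rc_field \<Rightarrow> 'a)"
  by (rule bounded_linear_intro[where K = 1])
    (simp_all add: conjg_add scaleR_conv_of_real conjg_mult conjg_of_real norm_conjg)


section \<open>Hilbert spaces\<close>

record ('f, 'h) inner_structure =
  hscale :: "'f \<Rightarrow> 'h \<Rightarrow> 'h"
  hinner :: "'h \<Rightarrow> 'h \<Rightarrow> 'f"

text \<open>
  Addition, norm and completeness come from the type class \<^class>\<open>banach\<close>; the inner product is linear
  in the first argument and induces the norm.
\<close>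

locale hilbert_space =
  fixes H :: "('f::rc_field, 'h::banach) inner_structure"
  assumes vector_space: "vector_space (hscale H)"
    and scale_of_real: "hscale H (of_real r) x = r *\<^sub>R x"
    and inner_add_left: "hinner H (x + y) z = hinner H x z + hinner H y z"
    and inner_scale_left: "hinner H (hscale H c x) y = c * hinner H x y"
    and inner_conjg: "hinner H y x = conjg (hinner H x y)"
    and inner_self: "hinner H x x = of_real ((norm x)\<^sup>2)"

context hilbert_space
begin

lemma inner_add_right: "hinner H x (y + z) = hinner H x y + hinner H x z"
  by (metis inner_conjg inner_add_left conjg_add)

lemma inner_scale_right: "hinner H x (hscale H c y) = conjg c * hinner H x y"
  by (metis inner_conjg inner_scale_left conjg_mult)

lemma norm_scale: "norm (hscale H c x) = norm c * norm x"
proof -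
  have "of_real ((norm (hscale H c x))\<^sup>2) = c * (conjg c * hinner H x x)"
    by (simp only: inner_self[symmetric] inner_scale_left inner_scale_right ac_simps)
  also have "\<dots> = of_real ((norm c * norm x)\<^sup>2)"
    by (simp only: inner_self mult.assoc[symmetric] mult_conjg of_real_mult[symmetric]
        power_mult_distrib)
  finally show ?thesis
    by (simp only: of_real_eq_iff) simp
qed

lemma Cauchy_Schwarz: "norm (hinner H x y) \<le> norm x * norm y"
proof (cases "y = 0")
  case True
  have "hinner H x 0 + hinner H x 0 = hinner H x 0" by (metis inner_add_right add_0)
  then show ?thesis using True by simp
next
  case False
  define a where "a = hinner H x y"
  define n where "n = (norm y)\<^sup>2"
  have n: "n > 0" using False by (simp add: n_def)
  define c where "c = - (a / of_real n)"
  have cn: "c * of_real n = - a" using n by (simp add: c_def)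
  have cj: "hinner H y x = conjg a" by (simp add: a_def inner_conjg[of y x])
  have "of_real ((norm (x + hscale H c y))\<^sup>2)
      = of_real ((norm x)\<^sup>2) + conjg c * a + c * conjg a + c * (conjg c * of_real n)"
    unfolding inner_self[symmetric] n_def
    by (simp add: inner_add_left inner_add_right inner_scale_left inner_scale_right cj a_def
        algebra_simps)
  also have "\<dots> = of_real ((norm x)\<^sup>2) + c * conjg a + conjg c * (a + c * of_real n)"
    by (simp add: algebra_simps)
  also have "\<dots> = of_real ((norm x)\<^sup>2) - (a * conjg a) / of_real n"
    by (simp add: cn) (simp add: c_def)
  also have "\<dots> = of_real ((norm x)\<^sup>2 - (norm a)\<^sup>2 / n)"
    by (simp add: mult_conjg)
  finally have "(norm (x + hscale H c y))\<^sup>2 = (norm x)\<^sup>2 - (norm a)\<^sup>2 / n"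
    by (simp only: of_real_eq_iff)
  then have "(norm a)\<^sup>2 / n \<le> (norm x)\<^sup>2" by (metis diff_ge_0_iff_ge zero_le_power2)
  then have "(norm a)\<^sup>2 \<le> (norm x * norm y)\<^sup>2"
    using n by (simp add: field_simps n_def power_mult_distrib)
  then show ?thesis unfolding a_def by (rule power2_le_imp_le) simp
qed

end

definition bounded_operator ::
  "('f, 'h::real_normed_vector) inner_structure \<Rightarrow> ('f, 'k::real_normed_vector) inner_structure
    \<Rightarrow> ('h \<Rightarrow> 'k) \<Rightarrow> bool" where
  "bounded_operator H K A \<longleftrightarrow>
     bounded_linear A \<and> (\<forall>c x. A (hscale H c x) = hscale K c (A x))"

definition adj ::
  "('f, 'h) inner_structure \<Rightarrow> ('f, 'k) inner_structure \<Rightarrow> ('h \<Rightarrow> 'k) \<Rightarrow> 'k \<Rightarrow> 'h" where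
  "adj H K A = (THE A'. \<forall>x y. hinner K (A x) y = hinner H x (A' y))"

definition orth_proj ::
  "('f::zero, 'h::minus) inner_structure \<Rightarrow> 'h set \<Rightarrow> 'h \<Rightarrow> 'h" where
  "orth_proj H V x = (THE p. p \<in> V \<and> (\<forall>v\<in>V. hinner H (x - p) v = 0))"

text \<open>For \<open>V = UNIV\<close> this is \<^const>\<open>onorm\<close>.\<close>

definition onorm_on :: "'h::real_normed_vector set \<Rightarrow> ('h \<Rightarrow> 'k::real_normed_vector) \<Rightarrow> real" where
  "onorm_on V f = (SUP x\<in>V. norm (f x) / norm x)"

definition delta ::
  "('f::zero, 'h::real_normed_vector) inner_structure \<Rightarrow> 'h set \<Rightarrow> 'h set \<Rightarrow> real" where
  "delta H V W = onorm_on V (\<lambda>x. x - orth_proj H W x)"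

definition gap ::
  "('f::zero, 'h::real_normed_vector) inner_structure \<Rightarrow> 'h set \<Rightarrow> 'h set \<Rightarrow> real" where
  "gap H V W = max (delta H V W) (delta H W V)"


section \<open>Square-summable sequences\<close>

text \<open>
  The space \<open>\<ell>\<^sup>2(I, K)\<close> for \<open>I \<subseteq> \<nat>\<close> is identified with the closed subspace of \<open>\<ell>\<^sup>2(\<nat>, K)\<close> of all
  sequences vanishing outside \<open>I\<close>.
\<close>

typedef (overloaded) 'k ell2 =
  "{f :: nat \<Rightarrow> 'k::real_normed_vector. (\<lambda>i. (norm (f i))\<^sup>2) summable_on UNIV}"
  morphisms ell2_nth Abs_ell2
  by (rule exI[of _ "\<lambda>_. 0"]) simp

setup_lifting type_definition_ell2

lemma ell2_summable: "(\<lambda>i. (norm (ell2_nth f i))\<^sup>2) summable_on UNIV"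
  using ell2_nth[of f] by simp

lemma norm_add_sq_le: "(norm (a + b))\<^sup>2 \<le> 2 * (norm a)\<^sup>2 + 2 * (norm (b :: 'k::real_normed_vector))\<^sup>2"
proof -
  have "(norm (a + b))\<^sup>2 \<le> (norm a + norm b)\<^sup>2"
    by (intro power_mono norm_triangle_ineq) simp
  also have "\<dots> \<le> 2 * (norm a)\<^sup>2 + 2 * (norm b)\<^sup>2"
    using sum_squares_bound[of "norm a" "norm b"] by (simp add: power2_sum)
  finally show ?thesis .
qed

lemma sq_summable_add:
  fixes f g :: "nat \<Rightarrow> 'k::real_normed_vector"
  assumes "(\<lambda>i. (norm (f i))\<^sup>2) summable_on UNIV" "(\<lambda>i. (norm (g i))\<^sup>2) summable_on UNIV"
  shows "(\<lambda>i. (norm (f i + g i))\<^sup>2) summable_on UNIV"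
proof (rule summable_on_comparison_test)
  show "(\<lambda>i. 2 * (norm (f i))\<^sup>2 + 2 * (norm (g i))\<^sup>2) summable_on UNIV"
    by (intro summable_on_add summable_on_cmult_right assms)
qed (simp_all add: norm_add_sq_le)

instantiation ell2 :: (real_normed_vector) real_normed_vector
begin

lift_definition zero_ell2 :: "'a ell2" is "\<lambda>_. 0" by simp
lift_definition plus_ell2 :: "'a ell2 \<Rightarrow> 'a ell2 \<Rightarrow> 'a ell2" is "\<lambda>f g i. f i + g i"
  by (rule sq_summable_add)
lift_definition uminus_ell2 :: "'a ell2 \<Rightarrow> 'a ell2" is "\<lambda>f i. - f i" by simp
lift_definition minus_ell2 :: "'a ell2 \<Rightarrow> 'a ell2 \<Rightarrow> 'a ell2" is "\<lambda>f g i. f i - g i"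
  subgoal for f g using sq_summable_add[of f "\<lambda>i. - g i"] by simp
  done
lift_definition scaleR_ell2 :: "real \<Rightarrow> 'a ell2 \<Rightarrow> 'a ell2" is "\<lambda>r f i. r *\<^sub>R f i"
  by (simp add: power_mult_distrib summable_on_cmult_right)
lift_definition norm_ell2 :: "'a ell2 \<Rightarrow> real" is "\<lambda>f. sqrt (\<Sum>\<^sub>\<infinity>i. (norm (f i))\<^sup>2)" .

definition sgn_ell2 :: "'a ell2 \<Rightarrow> 'a ell2" where "sgn_ell2 x = inverse (norm x) *\<^sub>R x"
definition dist_ell2 :: "'a ell2 \<Rightarrow> 'a ell2 \<Rightarrow> real" where "dist_ell2 x y = norm (x - y)"
definition uniformity_ell2 :: "('a ell2 \<times> 'a ell2) filter" where
  "uniformity_ell2 = (INF e\<in>{0<..}. principal {(x, y). dist x y < e})"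
definition open_ell2 :: "'a ell2 set \<Rightarrow> bool" where
  "open_ell2 U \<longleftrightarrow> (\<forall>x\<in>U. \<forall>\<^sub>F (x', y) in uniformity. x' = x \<longrightarrow> y \<in> U)"

lemma L2_set_le_ell2: "finite F \<Longrightarrow> L2_set (\<lambda>i. norm (ell2_nth f i)) F \<le> norm f"
  unfolding L2_set_def norm_ell2.rep_eq
  by (intro real_sqrt_le_mono finite_sum_le_infsum ell2_summable) simp_all

lemma norm_ell2_le:
  assumes "\<And>F. finite F \<Longrightarrow> L2_set (\<lambda>i. norm (ell2_nth f i)) F \<le> b"
  shows "norm f \<le> b"
proof -
  have b: "0 \<le> b" using assms[of "{}"] by simp
  have "(\<Sum>\<^sub>\<infinity>i. (norm (ell2_nth f i))\<^sup>2) \<le> b\<^sup>2"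
    by (rule infsum_le_finite_sums[OF ell2_summable])
      (use assms in \<open>simp add: L2_set_def sqrt_le_D\<close>)
  then show ?thesis unfolding norm_ell2.rep_eq using b by (rule real_le_lsqrt[rotated]) 
qed

instance
proof
  fix x y z :: "'a ell2" and r s :: real
  show "x + y + z = x + (y + z)" "x + y = y + x" "0 + x = x" "- x + x = 0" "x - y = x + - y"
    "r *\<^sub>R (x + y) = r *\<^sub>R x + r *\<^sub>R y" "(r + s) *\<^sub>R x = r *\<^sub>R x + s *\<^sub>R x"
    "r *\<^sub>R s *\<^sub>R x = (r * s) *\<^sub>R x" "1 *\<^sub>R x = x"
    by (transfer; simp add: algebra_simps)+
  show "dist x y = norm (x - y)" "sgn x = inverse (norm x) *\<^sub>R x"
    "uniformity = (INF e\<in>{0<..}. principal {(x :: 'a ell2, y). dist x y < e})"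
    by (simp_all add: dist_ell2_def sgn_ell2_def uniformity_ell2_def)
  show "open U \<longleftrightarrow> (\<forall>x\<in>U. \<forall>\<^sub>F (x', y) in uniformity. x' = x \<longrightarrow> y \<in> U)" for U :: "'a ell2 set"
    by (rule open_ell2_def)
  show "norm x = 0 \<longleftrightarrow> x = 0"
  proof
    assume n: "norm x = 0"
    have "norm (ell2_nth x i) \<le> 0" for i
      using L2_set_le_ell2[of "{i}" x] n by simp
    then have "ell2_nth x = (\<lambda>_. 0)" by auto
    then show "x = 0" by transfer
  qed (transfer, simp)
  show "norm (x + y) \<le> norm x + norm y"
  proof (rule norm_ell2_le)
    fix F :: "nat set" assume F: "finite F"
    have "L2_set (\<lambda>i. norm (ell2_nth (x + y) i)) F
        \<le> L2_set (\<lambda>i. norm (ell2_nth x i) + norm (ell2_nth y i)) F"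
      by (rule L2_set_mono) (simp_all add: plus_ell2.rep_eq norm_triangle_ineq)
    also have "\<dots> \<le> L2_set (\<lambda>i. norm (ell2_nth x i)) F + L2_set (\<lambda>i. norm (ell2_nth y i)) F"
      by (rule L2_set_triangle_ineq)
    also have "\<dots> \<le> norm x + norm y" by (intro add_mono L2_set_le_ell2 F)
    finally show "L2_set (\<lambda>i. norm (ell2_nth (x + y) i)) F \<le> norm x + norm y" .
  qed
  show "norm (r *\<^sub>R x) = \<bar>r\<bar> * norm x"
    by transfer (simp add: power_mult_distrib infsum_cmult_right' real_sqrt_mult)
qed

end

lemma norm_ell2_nth_le: "norm (ell2_nth f i) \<le> norm f"
  using L2_set_le_ell2[of "{i}" f] by simp

instance ell2 :: (banach) banach
proof
  fix X :: "nat \<Rightarrow> 'a ell2"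
  assume X: "Cauchy X"
  have coord: "Cauchy (\<lambda>n. ell2_nth (X n) i)" for i
  proof (rule metric_CauchyI)
    fix e :: real assume "e > 0"
    then obtain M where M: "\<And>m n. m \<ge> M \<Longrightarrow> n \<ge> M \<Longrightarrow> dist (X m) (X n) < e"
      using metric_CauchyD[OF X] by blast
    have "dist (ell2_nth (X m) i) (ell2_nth (X n) i) < e" if "m \<ge> M" "n \<ge> M" for m n
      using norm_ell2_nth_le[of "X m - X n" i] M[OF that]
      by (simp add: dist_norm minus_ell2.rep_eq)
    then show "\<exists>M. \<forall>m\<ge>M. \<forall>n\<ge>M. dist (ell2_nth (X m) i) (ell2_nth (X n) i) < e" by blast
  qed
  define l where "l i = lim (\<lambda>n. ell2_nth (X n) i)" for i
  have l: "(\<lambda>n. ell2_nth (X n) i) \<longlonglongrightarrow> l i" for i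
    unfolding l_def using coord[of i] by (simp add: Cauchy_convergent_iff convergent_LIMSEQ_iff)
  have L2_lim: "L2_set (\<lambda>i. norm (ell2_nth (X m) i - l i)) F \<le> e"
    if M: "\<And>n. n \<ge> M \<Longrightarrow> dist (X m) (X n) < e" and F: "finite F" for m M e F
  proof (rule tendsto_upperbound)
    show "(\<lambda>n. L2_set (\<lambda>i. norm (ell2_nth (X m) i - ell2_nth (X n) i)) F)
        \<longlonglongrightarrow> L2_set (\<lambda>i. norm (ell2_nth (X m) i - l i)) F"
      unfolding L2_set_def by (intro tendsto_intros l)
    show "\<forall>\<^sub>F n in sequentially. L2_set (\<lambda>i. norm (ell2_nth (X m) i - ell2_nth (X n) i)) F \<le> e"
      using eventually_ge_at_top[of M]
    proof eventually_elim
      case (elim n)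
      show ?case
        using L2_set_le_ell2[OF F, of "X m - X n"] M[OF elim]
        by (simp add: dist_norm minus_ell2.rep_eq)
    qed
  qed simp
  have diff: "(\<lambda>i. (norm (ell2_nth (X m) i - l i))\<^sup>2) summable_on UNIV"
    if M: "\<And>n. n \<ge> M \<Longrightarrow> dist (X m) (X n) < e" for m M e
  proof (rule nonneg_bdd_above_summable_on)
    show "bdd_above (sum (\<lambda>i. (norm (ell2_nth (X m) i - l i))\<^sup>2) ` {F. F \<subseteq> UNIV \<and> finite F})"
      by (rule bdd_aboveI2[where M = "e\<^sup>2"])
        (use L2_lim[OF M] in \<open>simp add: L2_set_def sqrt_le_D\<close>)
  qed simp
  have "(\<lambda>i. (norm (l i))\<^sup>2) summable_on UNIV"
  proof -
    obtain M where M: "\<And>m n. m \<ge> M \<Longrightarrow> n \<ge> M \<Longrightarrow> dist (X m) (X n) < 1"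
      using metric_CauchyD[OF X, of 1] by auto
    have "(\<lambda>i. (norm (- (ell2_nth (X M) i - l i)))\<^sup>2) summable_on UNIV"
      unfolding norm_minus_cancel by (rule diff[of M M 1]) (use M in simp)
    from sq_summable_add[OF ell2_summable[of "X M"] this] show ?thesis by simp
  qed
  then have nth: "ell2_nth (Abs_ell2 l) = l" by (simp add: Abs_ell2_inverse)
  have "X \<longlonglongrightarrow> Abs_ell2 l"
  proof (rule metric_LIMSEQ_I)
    fix e :: real assume e: "e > 0"
    then obtain M where M: "\<And>m n. m \<ge> M \<Longrightarrow> n \<ge> M \<Longrightarrow> dist (X m) (X n) < e / 2"
      using metric_CauchyD[OF X, of "e / 2"] by auto
    have "dist (X m) (Abs_ell2 l) < e" if "m \<ge> M" for m
    proof -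
      have "norm (X m - Abs_ell2 l) \<le> e / 2"
      proof (rule norm_ell2_le)
        fix F :: "nat set" assume "finite F"
        then show "L2_set (\<lambda>i. norm (ell2_nth (X m - Abs_ell2 l) i)) F \<le> e / 2"
          using L2_lim[of M m "e / 2" F] M[OF that] by (simp add: minus_ell2.rep_eq nth)
      qed
      then show ?thesis using e by (simp add: dist_norm)
    qed
    then show "\<exists>no. \<forall>n\<ge>no. dist (X n) (Abs_ell2 l) < e" by blast
  qed
  then show "convergent X" by (rule convergentI)
qed

definition ell2_structure ::
  "('f::rc_field, 'k::banach) inner_structure \<Rightarrow> ('f, 'k ell2) inner_structure" where
  "ell2_structure K =
    \<lparr>hscale = (\<lambda>c f. Abs_ell2 (\<lambda>i. hscale K c (ell2_nth f i))),
     hinner = (\<lambda>f g. \<Sum>\<^sub>\<infinity>i. hinner K (ell2_nth f i) (ell2_nth g i))\<rparr>"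

lemma hilbert_space_ell2:
  assumes "hilbert_space K"
  shows "hilbert_space (ell2_structure K)"
proof -
  interpret K: hilbert_space K by fact
  interpret V: vector_space "hscale K" by (rule K.vector_space)
  have nth_scale: "ell2_nth (hscale (ell2_structure K) c f) i = hscale K c (ell2_nth f i)" for c f i
    unfolding ell2_structure_def
    by (simp add: Abs_ell2_inverse K.norm_scale power_mult_distrib summable_on_cmult_right
        ell2_summable)
  have inner: "hinner (ell2_structure K) f g = (\<Sum>\<^sub>\<infinity>i. hinner K (ell2_nth f i) (ell2_nth g i))" for f g
    by (simp add: ell2_structure_def)
  have summable: "(\<lambda>i. hinner K (ell2_nth f i) (ell2_nth g i)) summable_on UNIV" for f g
  proof (rule Infinite_Sum.abs_summable_summable, rule Infinite_Sum.abs_summable_on_comparison_test')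
    show "(\<lambda>i. (norm (ell2_nth f i))\<^sup>2 + (norm (ell2_nth g i))\<^sup>2) summable_on UNIV"
      by (intro summable_on_add ell2_summable)
    show "norm (hinner K (ell2_nth f i) (ell2_nth g i))
        \<le> (norm (ell2_nth f i))\<^sup>2 + (norm (ell2_nth g i))\<^sup>2" for i
    proof -
      have "norm (ell2_nth f i) * norm (ell2_nth g i)
          \<le> (norm (ell2_nth f i))\<^sup>2 + (norm (ell2_nth g i))\<^sup>2"
        using sum_squares_bound[of "norm (ell2_nth f i)" "norm (ell2_nth g i)"]
          mult_nonneg_nonneg[OF norm_ge_zero[of "ell2_nth f i"] norm_ge_zero[of "ell2_nth g i"]]
        by linarith
      with K.Cauchy_Schwarz[of "ell2_nth f i" "ell2_nth g i"] show ?thesis by linarith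
    qed
  qed
  show ?thesis
  proof
    fix r :: real and c d :: 'a and x y z :: "'b ell2"
    show "hscale (ell2_structure K) c (x + y)
        = hscale (ell2_structure K) c x + hscale (ell2_structure K) c y"
      "hscale (ell2_structure K) (c + d) x
        = hscale (ell2_structure K) c x + hscale (ell2_structure K) d x"
      "hscale (ell2_structure K) c (hscale (ell2_structure K) d x)
        = hscale (ell2_structure K) (c * d) x"
      "hscale (ell2_structure K) 1 x = x"
      "hscale (ell2_structure K) (of_real r) x = r *\<^sub>R x"
      by (auto simp: ell2_nth_inject[symmetric] fun_eq_iff nth_scale plus_ell2.rep_eq
          scaleR_ell2.rep_eq K.scale_of_real V.scale_right_distrib V.scale_left_distrib)
    show "hinner (ell2_structure K) (x + y) z
        = hinner (ell2_structure K) x z + hinner (ell2_structure K) y z"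
      by (simp add: inner plus_ell2.rep_eq K.inner_add_left infsum_add summable)
    show "hinner (ell2_structure K) (hscale (ell2_structure K) c x) y
        = c * hinner (ell2_structure K) x y"
      by (simp add: inner nth_scale K.inner_scale_left infsum_cmult_right')
    show "hinner (ell2_structure K) y x = conjg (hinner (ell2_structure K) x y)"
      unfolding inner
      using has_sum_bounded_linear[OF bounded_linear_conjg has_sum_infsum[OF summable[of x y]]]
      by (intro infsumI) (simp flip: K.inner_conjg)
    show "hinner (ell2_structure K) x x = of_real ((norm x)\<^sup>2)"
    proof -
      have "(norm x)\<^sup>2 = (\<Sum>\<^sub>\<infinity>i. (norm (ell2_nth x i))\<^sup>2)"
        unfolding norm_ell2.rep_eq by (simp add: infsum_nonneg)
      then show ?thesis
        unfolding inner K.inner_self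
        by (metis infsumI has_sum_of_real has_sum_infsum[OF ell2_summable])
    qed
  qed
qed


section \<open>Operator-valued Bessel and frame sequences\<close>

definition bessel_sequence ::
  "('f, 'h::real_normed_vector) inner_structure \<Rightarrow> ('f, 'k::real_normed_vector) inner_structure
    \<Rightarrow> nat set \<Rightarrow> (nat \<Rightarrow> 'h \<Rightarrow> 'k) \<Rightarrow> bool" where
  "bessel_sequence H K I A \<longleftrightarrow>
     (\<forall>i\<in>I. bounded_operator H K (A i)) \<and>
     (\<exists>\<beta>>0. \<forall>x. (\<lambda>i. (norm (A i x))\<^sup>2) summable_on I \<and>
                 (\<Sum>\<^sub>\<infinity>i\<in>I. (norm (A i x))\<^sup>2) \<le> \<beta> * (norm x)\<^sup>2)"

definition range_space ::
  "('f::rc_field, 'h::banach) inner_structure \<Rightarrow> ('f, 'k) inner_structure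
    \<Rightarrow> nat set \<Rightarrow> (nat \<Rightarrow> 'h \<Rightarrow> 'k) \<Rightarrow> 'h set" where
  "range_space H K I A = closure (module.span (hscale H) (\<Union>i\<in>I. range (adj H K (A i))))"

definition analysis_op :: "nat set \<Rightarrow> (nat \<Rightarrow> 'h \<Rightarrow> 'k::real_normed_vector) \<Rightarrow> 'h \<Rightarrow> 'k ell2" where
  "analysis_op I A x = Abs_ell2 (\<lambda>i. if i \<in> I then A i x else 0)"

definition frame_op ::
  "('f::rc_field, 'h) inner_structure \<Rightarrow> ('f, 'k::banach) inner_structure
    \<Rightarrow> nat set \<Rightarrow> (nat \<Rightarrow> 'h \<Rightarrow> 'k) \<Rightarrow> 'h \<Rightarrow> 'h" where
  "frame_op H K I A = adj H (ell2_structure K) (analysis_op I A) \<circ> analysis_op I A"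

definition frame_sequence_bounds ::
  "('f::rc_field, 'h::banach) inner_structure \<Rightarrow> ('f, 'k::banach) inner_structure
    \<Rightarrow> nat set \<Rightarrow> (nat \<Rightarrow> 'h \<Rightarrow> 'k) \<Rightarrow> real \<Rightarrow> real \<Rightarrow> bool" where
  "frame_sequence_bounds H K I A \<alpha> \<beta> \<longleftrightarrow>
     0 < \<alpha> \<and> 0 < \<beta> \<and>
     (\<forall>i\<in>I. bounded_operator H K (A i)) \<and>
     (\<forall>x\<in>range_space H K I A.
        (\<lambda>i. (norm (A i x))\<^sup>2) summable_on I \<and>
        \<alpha> * (norm x)\<^sup>2 \<le> (\<Sum>\<^sub>\<infinity>i\<in>I. (norm (A i x))\<^sup>2) \<and>
        (\<Sum>\<^sub>\<infinity>i\<in>I. (norm (A i x))\<^sup>2) \<le> \<beta> * (norm x)\<^sup>2)"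

definition frame_sequence ::
  "('f::rc_field, 'h::banach) inner_structure \<Rightarrow> ('f, 'k::banach) inner_structure
    \<Rightarrow> nat set \<Rightarrow> (nat \<Rightarrow> 'h \<Rightarrow> 'k) \<Rightarrow> bool" where
  "frame_sequence H K I A \<longleftrightarrow> (\<exists>\<alpha> \<beta>. frame_sequence_bounds H K I A \<alpha> \<beta>)"

definition canonical_dual ::
  "('f::rc_field, 'h::banach) inner_structure \<Rightarrow> ('f, 'k::banach) inner_structure
    \<Rightarrow> nat set \<Rightarrow> (nat \<Rightarrow> 'h \<Rightarrow> 'k) \<Rightarrow> nat \<Rightarrow> 'h \<Rightarrow> 'k" where
  "canonical_dual H K I A i =
     A i \<circ> inv_into (range_space H K I A) (frame_op H K I A) \<circ> orth_proj H (range_space H K I A)"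

definition perturbation ::
  "('f, 'h::real_normed_vector) inner_structure \<Rightarrow> ('f, 'k::real_normed_vector) inner_structure
    \<Rightarrow> nat set \<Rightarrow> real \<Rightarrow> (nat \<Rightarrow> 'h \<Rightarrow> 'k) \<Rightarrow> (nat \<Rightarrow> 'h \<Rightarrow> 'k) \<Rightarrow> bool" where
  "perturbation H K I \<mu> A B \<longleftrightarrow>
     bessel_sequence H K I A \<and> bessel_sequence H K I B \<and>
     onorm (\<lambda>x. analysis_op I A x - analysis_op I B x) \<le> \<mu>"

end

theory Submission
  imports Defs
begin

text \<open>
  Write \<open>X\<close>, \<open>Y\<close> for the analysis operators, \<open>V\<close>, \<open>W\<close> for the range spaces, \<open>a = sqrt \<alpha>\<close> and
  \<open>b = a - \<mu>\<close>. On \<open>V\<close> the operator \<open>Y\<close> is bounded below by \<open>b\<close>; since \<open>\<Delta> < 1\<close> the projection onto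
  \<open>W\<close> maps \<open>V\<close> onto \<open>W\<close>, and as \<open>Y\<close> vanishes on the complement of \<open>W\<close> the same bound holds on \<open>W\<close>.
  For the duals, fix \<open>h\<close>. The canonical duals send it to \<open>X u\<close> and \<open>Y v\<close>, where \<open>u \<in> V\<close> satisfies
  \<open>\<langle>X z, X u\<rangle> = \<langle>z, h\<rangle>\<close> for \<open>z \<in> V\<close>, and likewise \<open>v \<in> W\<close>. If \<open>Y t\<close> is the projection of \<open>X u\<close>
  onto the range of \<open>Y\<close>, then \<open>\<parallel>X u - Y t\<parallel> \<le> \<parallel>X u - Y u\<parallel> \<le> \<mu> \<parallel>h\<parallel> / a\<^sup>2\<close>, and \<open>z = t - v\<close> satisfies
  \<open>\<parallel>Y z\<parallel>\<^sup>2 = \<langle>(Y - X) z, X u\<rangle> - \<langle>z - P z, h\<rangle> \<le> (\<mu> / a + \<Delta>) \<parallel>h\<parallel> \<parallel>Y z\<parallel> / b\<close>, with \<open>P\<close> the projection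
  onto \<open>V\<close>. So the difference of the dual analysis operators has norm at most
  \<open>\<mu> / a\<^sup>2 + \<mu> / (a b) + \<Delta> / b\<close>, which is below the claimed bound.
\<close>

section \<open>Closed subspaces of a Hilbert space\<close>

text \<open>A solution of \<open>R x = y\<close> is a fixed point of
  \<open>\<lambda>x. y + (x - R x)\<close>, a contraction of the complete set \<open>W\<close>. Both
  the frame operator and a product of two projections are treated this way.\<close>

lemma perturbed_identity_surj:
  fixes R :: "'h::banach \<Rightarrow> 'h"
  assumes "closed W"
    and "\<And>x y. x \<in> W \<Longrightarrow> y \<in> W \<Longrightarrow> x + y \<in> W" "\<And>x y. x \<in> W \<Longrightarrow> y \<in> W \<Longrightarrow> x - y \<in> W"
    and "\<And>x. x \<in> W \<Longrightarrow> R x \<in> W" "\<And>x y. R (x - y) = R x - R y"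
    and "\<And>x. x \<in> W \<Longrightarrow> norm (x - R x) \<le> \<theta> * norm x" "\<theta> < 1" "y \<in> W"
  obtains x where "x \<in> W" "R x = y"
proof -
  let ?f = "\<lambda>x. y + (x - R x)"
  have "\<exists>!x\<in>W. ?f x = x"
  \<comment> \<open>The sign of \<open>\<theta>\<close> is unknown, while the fixed point theorem
    asks for a nonnegative constant.\<close>
  proof (rule Banach_fix[where c = "max \<theta> 0"])
    show "complete W" using assms(1) by (simp add: complete_eq_closed)
    show "?f ` W \<subseteq> W" using assms(2-4,8) by blast
    fix u v assume "u \<in> W" "v \<in> W"
    then have "u - v \<in> W" using assms by blast
    have "dist (?f u) (?f v) = norm ((u - v) - R (u - v))"
      by (simp add: dist_norm assms(5) algebra_simps)
    also have "\<dots> \<le> \<theta> * norm (u - v)" by (rule assms(6)[OF \<open>u - v \<in> W\<close>])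
    also have "\<dots> \<le> max \<theta> 0 * norm (u - v)" by (rule mult_right_mono) auto
    finally show "dist (?f u) (?f v) \<le> max \<theta> 0 * dist u v" by (simp add: dist_norm)
  qed (use assms(7,8) in auto)
  then obtain x where "x \<in> W" "y + (x - R x) = x" by blast
  then have "R x = y" by (simp add: algebra_simps)
  with \<open>x \<in> W\<close> that show thesis by blast
qed

context hilbert_space
begin

sublocale VS: vector_space "hscale H"
  by (rule vector_space)

lemma inner_zero_left [simp]: "hinner H 0 y = 0"
  using inner_add_left[of 0 0 y] by simp

lemma inner_zero_right [simp]: "hinner H x 0 = 0"
  using inner_add_right[of x 0 0] by simp

lemma inner_diff_left: "hinner H (x - y) z = hinner H x z - hinner H y z"
  using inner_add_left[of "x - y" y z] by simp

lemma inner_diff_right: "hinner H x (y - z) = hinner H x y - hinner H x z"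
  using inner_add_right[of x "y - z" z] by simp

lemma inner_commute_zero: "hinner H x y = 0 \<Longrightarrow> hinner H y x = 0"
  using inner_conjg[of y x] norm_conjg[of "0::'f"] by simp

lemma inner_self_eq_zero [simp]: "hinner H x x = 0 \<longleftrightarrow> x = 0"
  by (simp add: inner_self)

lemma norm_inner_self: "norm (hinner H x x) = (norm x)\<^sup>2"
  by (simp only: inner_self norm_of_real abs_power2)

lemma eq_if_inner_eq:
  assumes "\<And>z. hinner H z x = hinner H z y"
  shows "x = y"
proof -
  have "hinner H (x - y) (x - y) = 0" using assms by (simp add: inner_diff_right)
  then show ?thesis by simp
qed

lemma bounded_linear_inner_left: "bounded_linear (\<lambda>x. hinner H x y)"
proof (rule bounded_linear_intro[where K = "norm y"])
  show "hinner H (r *\<^sub>R x) y = r *\<^sub>R hinner H x y" for r x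
    by (simp add: scale_of_real[symmetric] inner_scale_left scaleR_conv_of_real)
qed (simp_all add: inner_add_left Cauchy_Schwarz)

lemma bounded_linear_scale: "bounded_linear (hscale H c)"
proof (rule bounded_linear_intro[where K = "norm c"])
  show "hscale H c (r *\<^sub>R x) = r *\<^sub>R hscale H c x" for r x
    by (simp add: scale_of_real[symmetric] VS.scale_scale mult.commute)
qed (simp_all add: VS.scale_right_distrib norm_scale mult.commute)

section \<open>Pythagoras, parallelogram law and best approximation\<close>

lemma pythagoras:
  assumes "hinner H x y = 0"
  shows "(norm (x + y))\<^sup>2 = (norm x)\<^sup>2 + (norm y)\<^sup>2"
proof -
  have "of_real ((norm (x + y))\<^sup>2) = (of_real ((norm x)\<^sup>2 + (norm y)\<^sup>2) :: 'f)"
    by (simp only: inner_self[symmetric] of_real_add inner_add_left inner_add_right assms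
        inner_commute_zero[OF assms]) simp
  then show ?thesis by (simp only: of_real_eq_iff)
qed

lemma parallelogram:
  fixes x y :: 'h
  shows "(norm (x + y))\<^sup>2 + (norm (x - y))\<^sup>2 = 2 * (norm x)\<^sup>2 + 2 * (norm y)\<^sup>2"
proof -
  have "hinner H (x + y) (x + y) + hinner H (x - y) (x - y)
      = (hinner H x x + hinner H x x) + (hinner H y y + hinner H y y)"
    by (simp only: inner_add_left inner_add_right inner_diff_left inner_diff_right)
      (simp add: algebra_simps)
  then have "(norm (x + y))\<^sup>2 + (norm (x - y))\<^sup>2
      = ((norm x)\<^sup>2 + (norm x)\<^sup>2) + ((norm y)\<^sup>2 + (norm y)\<^sup>2)"
    by (simp only: inner_self of_real_add[symmetric] of_real_eq_iff)
  then show ?thesis by simp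
qed

text \<open>By Pythagoras, removing from \<open>x\<close> its component along \<open>v\<close>
  shortens it unless that component is zero.\<close>

lemma orthogonal_if_norm_minimal:
  assumes "\<And>c. norm x \<le> norm (x - hscale H c v)"
  shows "hinner H x v = 0"
proof (cases "v = 0")
  case False
  define c where "c = hinner H x v / of_real ((norm v)\<^sup>2)"
  have "hinner H (x - hscale H c v) v = 0"
    using False by (simp add: inner_diff_left inner_scale_left inner_self c_def)
  then have "hinner H (x - hscale H c v) (hscale H c v) = 0"
    by (simp add: inner_scale_right)
  from pythagoras[OF this] have "(norm x)\<^sup>2 = (norm (x - hscale H c v))\<^sup>2 + (norm (hscale H c v))\<^sup>2"
    by simp
  moreover have "(norm x)\<^sup>2 \<le> (norm (x - hscale H c v))\<^sup>2"
    using assms by (intro power_mono) auto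
  ultimately have "(norm (hscale H c v))\<^sup>2 \<le> 0" by linarith
  then have "norm c * norm v = 0" by (simp add: norm_scale)
  then show ?thesis using False by (simp add: c_def)
qed simp

text \<open>The sets \<open>S n\<close> of near-minimizers are closed, nested and nonempty with
  diameters tending to zero, so completeness gives a common point.\<close>

lemma norm_minimizer_exists:
  assumes V: "closed V" "VS.subspace V"
  obtains p where "p \<in> V" "\<And>v. v \<in> V \<Longrightarrow> norm (x - p) \<le> norm (x - v)"
proof -
  have ne: "V \<noteq> {}" using VS.subspace_0[OF V(2)] by blast
  define d where "d = infdist x V"
  have d: "0 \<le> d" "\<And>v. v \<in> V \<Longrightarrow> d \<le> norm (x - v)"
    unfolding d_def by (auto simp: infdist_nonneg dist_norm[symmetric] infdist_le)
  define S where "S n = {v \<in> V. (norm (x - v))\<^sup>2 \<le> d\<^sup>2 + 1 / Suc n}" for n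
  \<comment> \<open>The midpoint of \<open>v\<close> and \<open>w\<close> lies in \<open>V\<close>,
    hence at distance at least \<open>d\<close> from \<open>x\<close>; the parallelogram law for
    \<open>x - v\<close> and \<open>x - w\<close> leaves at most
    \<open>4 * (d\<^sup>2 + 1 / Suc n) - 4 * d\<^sup>2\<close>.\<close>
  have diam: "(dist v w)\<^sup>2 \<le> 4 / Suc n" if vw: "v \<in> S n" "w \<in> S n" for v w n
  proof -
    have "hscale H (of_real (1/2)) (v + w) \<in> V"
      using vw V(2) by (intro VS.subspace_scale VS.subspace_add) (auto simp: S_def)
    then have "(1/2) *\<^sub>R (v + w) \<in> V" by (simp only: scale_of_real)
    then have "d \<le> norm (x - (1/2) *\<^sub>R (v + w))" by (rule d)
    then have "d\<^sup>2 \<le> (norm (x - (1/2) *\<^sub>R (v + w)))\<^sup>2" using d by (intro power_mono)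
    moreover have "(x - v) + (x - w) = 2 *\<^sub>R (x - (1/2) *\<^sub>R (v + w))"
      by (simp add: algebra_simps scaleR_2)
    then have "(norm ((x - v) + (x - w)))\<^sup>2 = 4 * (norm (x - (1/2) *\<^sub>R (v + w)))\<^sup>2"
      by (simp add: power_mult_distrib)
    moreover have "(norm ((x - v) - (x - w)))\<^sup>2 = (dist v w)\<^sup>2"
      by (simp add: dist_norm norm_minus_commute)
    ultimately show ?thesis
      using parallelogram[of "x - v" "x - w"] vw by (simp add: S_def)
  qed
  obtain p where p: "\<And>n. p \<in> S n"
  proof (rule decreasing_closed_nest[of S])
    fix n
    have "closed (V \<inter> {v. (norm (x - v))\<^sup>2 \<le> d\<^sup>2 + 1 / Suc n})"
      by (intro closed_Int V closed_Collect_le continuous_intros)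
    then show "closed (S n)" by (simp add: S_def Int_def)
    have "d < sqrt (d\<^sup>2 + 1 / Suc n)" using d by (intro real_less_rsqrt) auto
    then obtain v where "v \<in> V" "norm (x - v) < sqrt (d\<^sup>2 + 1 / Suc n)"
      using cINF_greatest[OF ne, of "sqrt (d\<^sup>2 + 1 / Suc n)" "dist x"]
      unfolding d_def infdist_notempty[OF ne] dist_norm by (meson linorder_not_less)
    then have "(norm (x - v))\<^sup>2 \<le> (sqrt (d\<^sup>2 + 1 / Suc n))\<^sup>2" by (intro power_mono) auto
    then show "S n \<noteq> {}" using \<open>v \<in> V\<close> by (auto simp: S_def)
  next
    fix m n :: nat assume "m \<le> n"
    then have "1 / real (Suc n) \<le> 1 / Suc m" by (simp add: field_simps)
    then show "S n \<subseteq> S m" unfolding S_def by force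
  next
    fix e :: real assume "e > 0"
    then obtain n where n: "4 / e\<^sup>2 < Suc n"
      using reals_Archimedean2[of "4 / e\<^sup>2"] by (metis less_trans of_nat_less_iff lessI)
    have "dist v w < e" if "v \<in> S n" "w \<in> S n" for v w
    proof -
      have "4 / Suc n < e\<^sup>2" using n \<open>e > 0\<close> by (simp add: field_simps)
      with diam[OF that] have "(dist v w)\<^sup>2 < e\<^sup>2" by (rule order_le_less_trans)
      then show ?thesis using \<open>e > 0\<close> by (simp add: power2_less_imp_less)
    qed
    then show "\<exists>n. \<forall>v\<in>S n. \<forall>w\<in>S n. dist v w < e" by blast
  qed blast
  have "(\<lambda>n. d\<^sup>2 + 1 / real (Suc n)) \<longlonglongrightarrow> d\<^sup>2 + 0"
    using LIMSEQ_inverse_real_of_nat by (intro tendsto_intros) (simp add: inverse_eq_divide)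
  then have "(norm (x - p))\<^sup>2 \<le> d\<^sup>2"
    using p by (intro LIMSEQ_le_const[of _ "d\<^sup>2"]) (auto simp: S_def)
  then have "norm (x - p) \<le> d" using d(1) by (rule power2_le_imp_le)
  then show thesis using that[of p] p d(2) by (force simp: S_def)
qed

text \<open>The definite description denotes: a nearest point has an orthogonal residual, and two
  candidates differ by a vector of \<open>V\<close> that is orthogonal to itself.\<close>

lemma orth_proj_works:
  assumes V: "closed V" "VS.subspace V"
  shows "orth_proj H V x \<in> V \<and> (\<forall>v\<in>V. hinner H (x - orth_proj H V x) v = 0)"
  unfolding orth_proj_def
proof (rule theI')
  obtain p where p: "p \<in> V" "\<And>v. v \<in> V \<Longrightarrow> norm (x - p) \<le> norm (x - v)"
    using norm_minimizer_exists[OF V] by blast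
  have orth: "hinner H (x - p) v = 0" if "v \<in> V" for v
  proof (rule orthogonal_if_norm_minimal)
    fix c
    have "p + hscale H c v \<in> V" using V p that by (intro VS.subspace_add VS.subspace_scale)
    from p(2)[OF this] show "norm (x - p) \<le> norm (x - p - hscale H c v)"
      by (simp add: algebra_simps)
  qed
  show "\<exists>!p. p \<in> V \<and> (\<forall>v\<in>V. hinner H (x - p) v = 0)"
  proof (rule ex1I[of _ p])
    fix q assume q: "q \<in> V \<and> (\<forall>v\<in>V. hinner H (x - q) v = 0)"
    then have "q - p \<in> V" using p V by (simp add: VS.subspace_diff)
    then have "hinner H (x - p - (x - q)) (q - p) = 0"
      using q orth inner_diff_left[of "x - p" "x - q"] by simp
    then show "q = p" by simp
  qed (use p orth in auto)
qed

lemmas orth_proj_in = orth_proj_works[THEN conjunct1]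
lemmas orth_proj_orthogonal = orth_proj_works[THEN conjunct2, rule_format]

section \<open>Calculus of orthogonal projections\<close>

lemma orth_proj_eqI:
  assumes V: "closed V" "VS.subspace V" and p: "p \<in> V" "\<And>v. v \<in> V \<Longrightarrow> hinner H (x - p) v = 0"
  shows "orth_proj H V x = p"
proof -
  let ?q = "orth_proj H V x"
  have q: "?q \<in> V" "\<And>v. v \<in> V \<Longrightarrow> hinner H (x - ?q) v = 0"
    using orth_proj_in[OF V] orth_proj_orthogonal[OF V] by auto
  have "?q - p \<in> V" using p q V by (simp add: VS.subspace_diff)
  then have "hinner H (x - p - (x - ?q)) (?q - p) = 0"
    using q p inner_diff_left[of "x - p" "x - ?q"] by simp
  then show ?thesis by simp
qed

lemma orth_proj_diff:
  assumes V: "closed V" "VS.subspace V"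
  shows "orth_proj H V (x - y) = orth_proj H V x - orth_proj H V y"
proof (rule orth_proj_eqI[OF V])
  show "orth_proj H V x - orth_proj H V y \<in> V"
    using V by (simp add: VS.subspace_diff orth_proj_in)
  fix v assume v: "v \<in> V"
  have "x - y - (orth_proj H V x - orth_proj H V y)
      = (x - orth_proj H V x) - (y - orth_proj H V y)" by simp
  then show "hinner H (x - y - (orth_proj H V x - orth_proj H V y)) v = 0"
    by (simp only: inner_diff_left[of "x - orth_proj H V x"] orth_proj_orthogonal[OF V v]) simp
qed

lemma orth_proj_id:
  assumes "closed V" "VS.subspace V" "x \<in> V"
  shows "orth_proj H V x = x"
  using assms by (intro orth_proj_eqI) auto

lemma norm_orth_proj_sq:
  assumes V: "closed V" "VS.subspace V"
  shows "(norm x)\<^sup>2 = (norm (x - orth_proj H V x))\<^sup>2 + (norm (orth_proj H V x))\<^sup>2"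
proof -
  have "hinner H (x - orth_proj H V x) (orth_proj H V x) = 0"
    by (intro orth_proj_orthogonal orth_proj_in V)
  from pythagoras[OF this] show ?thesis by simp
qed

lemma norm_orth_proj_le:
  assumes V: "closed V" "VS.subspace V"
  shows "norm (orth_proj H V x) \<le> norm x" "norm (x - orth_proj H V x) \<le> norm x"
  by (rule power2_le_imp_le; simp add: norm_orth_proj_sq[OF V, of x])+

section \<open>The one-sided gap\<close>

lemma delta_upper:
  assumes V: "closed V" "VS.subspace V" and "x \<in> W"
  shows "norm (x - orth_proj H V x) / norm x \<le> delta H W V"
proof -
  \<comment> \<open>The supremum of reals needs an upper bound; at \<open>y = 0\<close> the quotient
    is \<open>0\<close> by convention.\<close>
  have "norm (y - orth_proj H V y) / norm y \<le> 1" for y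
    using norm_orth_proj_le(2)[OF V, of y] by (simp add: divide_le_eq)
  then have "bdd_above ((\<lambda>y. norm (y - orth_proj H V y) / norm y) ` W)"
    by (auto intro!: bdd_aboveI2)
  then show ?thesis
    unfolding delta_def onorm_on_def using \<open>x \<in> W\<close> by (rule cSUP_upper[rotated])
qed

lemma norm_diff_orth_proj_le_delta:
  assumes V: "closed V" "VS.subspace V" and "x \<in> W"
  shows "norm (x - orth_proj H V x) \<le> delta H W V * norm x"
proof (cases "x = 0")
  case True
  then show ?thesis using orth_proj_id[OF V] VS.subspace_0[OF V(2)] by simp
next
  case False
  then show ?thesis using delta_upper[OF assms] by (simp add: divide_le_eq)
qed

text \<open>The quotient at the zero vector has value \<open>0\<close> and takes part in the
  supremum.\<close>

lemma delta_nonneg: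
  assumes "closed V" "VS.subspace V" "0 \<in> W"
  shows "0 \<le> delta H W V"
  using delta_upper[OF assms] by simp

section \<open>Closures of subspaces and the Riesz representation\<close>

lemma subspace_closure:
  assumes "VS.subspace V"
  shows "VS.subspace (closure V)"
proof (rule VS.subspaceI)
  show "0 \<in> closure V" using VS.subspace_0[OF assms] closure_subset by blast
next
  fix x y assume "x \<in> closure V" "y \<in> closure V"
  then obtain f g where "\<And>n. f n \<in> V" "f \<longlonglongrightarrow> x" "\<And>n. g n \<in> V" "g \<longlonglongrightarrow> y"
    unfolding closure_sequential by blast
  then have "(\<lambda>n. f n + g n) \<longlonglongrightarrow> x + y" "\<And>n. f n + g n \<in> V"
    using assms by (auto intro: tendsto_add VS.subspace_add)
  then show "x + y \<in> closure V"
    unfolding closure_sequential by (intro exI[of _ "\<lambda>n. f n + g n"]) blast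
next
  fix c x assume "x \<in> closure V"
  then obtain f where "\<And>n. f n \<in> V" "f \<longlonglongrightarrow> x"
    unfolding closure_sequential by blast
  then have "(\<lambda>n. hscale H c (f n)) \<longlonglongrightarrow> hscale H c x" "\<And>n. hscale H c (f n) \<in> V"
    using assms by (auto intro: bounded_linear.tendsto[OF bounded_linear_scale] VS.subspace_scale)
  then show "hscale H c x \<in> closure V"
    unfolding closure_sequential by (intro exI[of _ "\<lambda>n. hscale H c (f n)"]) blast
qed

text \<open>The residual \<open>r\<close> of a vector outside the kernel \<open>N\<close> is
  orthogonal to \<open>N\<close>, and every \<open>x\<close> is a multiple of \<open>r\<close> up to
  an element of \<open>N\<close>; a scaled \<open>r\<close> therefore represents
  \<open>\<phi>\<close>.\<close>

lemma riesz_representation: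
  assumes bl: "bounded_linear \<phi>" and sc: "\<And>c x. \<phi> (hscale H c x) = c * \<phi> x"
  obtains y where "\<And>x. \<phi> x = hinner H x y"
proof (cases "\<forall>x. \<phi> x = 0")
  case True
  then show thesis using that[of 0] by simp
next
  case False
  then obtain x0 where x0: "\<phi> x0 \<noteq> 0" by blast
  interpret \<phi>: bounded_linear \<phi> by fact
  define N where "N = {x. \<phi> x = 0}"
  have N: "closed N" "VS.subspace N"
    unfolding N_def
    by (auto intro!: closed_Collect_eq \<phi>.continuous_on VS.subspaceI continuous_intros
        simp: \<phi>.zero \<phi>.add sc)
  define r where "r = x0 - orth_proj H N x0"
  have "\<phi> r = \<phi> x0" using orth_proj_in[OF N, of x0] by (simp add: r_def \<phi>.diff N_def)
  with x0 have \<phi>r: "\<phi> r \<noteq> 0" by simp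
  then have r0: "r \<noteq> 0" using \<phi>.zero by auto
  \<comment> \<open>The scalar is fixed by the case \<open>x = r\<close>, and conjugated because the
    inner product is conjugate-linear in its second argument.\<close>
  have "\<phi> x = hinner H x (hscale H (conjg (\<phi> r / of_real ((norm r)\<^sup>2))) r)" for x
  proof -
    have "x - hscale H (\<phi> x / \<phi> r) r \<in> N" using \<phi>r by (simp add: N_def \<phi>.diff sc)
    then have "hinner H r (x - hscale H (\<phi> x / \<phi> r) r) = 0"
      unfolding r_def by (rule orth_proj_orthogonal[OF N])
    from inner_commute_zero[OF this] have "hinner H x r = \<phi> x / \<phi> r * of_real ((norm r)\<^sup>2)"
      by (simp only: inner_diff_left inner_scale_left inner_self) simp
    then show ?thesis using \<phi>r r0 by (simp add: inner_scale_right conjg_conjg)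
  qed
  then show thesis by (rule that)
qed

end

section \<open>Adjoints and operators bounded below on a subspace\<close>

text \<open>Riesz gives existence and nondegeneracy gives uniqueness, so the definite description in
  \<open>adj\<close> denotes the adjoint.\<close>

lemma adj_works:
  assumes "hilbert_space H" "hilbert_space K" and T: "bounded_operator H K T"
  shows "hinner K (T x) y = hinner H x (adj H K T y)"
proof -
  interpret H: hilbert_space H by fact
  interpret K: hilbert_space K by fact
  have bl: "bounded_linear T" and sc: "\<And>c x. T (hscale H c x) = hscale K c (T x)"
    using T by (auto simp: bounded_operator_def)
  have "\<exists>z. \<forall>x. hinner K (T x) y = hinner H x z" for y
    by (rule H.riesz_representation[of "\<lambda>x. hinner K (T x) y"])
      (auto simp: sc K.inner_scale_left
        intro: bounded_linear_compose[OF K.bounded_linear_inner_left bl])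
  then obtain S where S: "\<And>x y. hinner K (T x) y = hinner H x (S y)" by metis
  have "\<forall>x y. hinner K (T x) y = hinner H x (adj H K T y)"
    unfolding adj_def
  proof (rule theI[of _ S])
    fix S' assume "\<forall>x y. hinner K (T x) y = hinner H x (S' y)"
    then show "S' = S" by (intro ext H.eq_if_inner_eq) (simp flip: S)
  qed (simp add: S)
  then show ?thesis by blast
qed

text \<open>The assumptions make the kernel of \<open>T\<close> the orthogonal complement of
  \<open>V\<close>. Both analysis operators are instances, with \<open>V\<close> the range space and
  \<open>a\<close> the square root of a lower frame bound.\<close>

locale operator_bounded_below =
  H: hilbert_space H + K: hilbert_space K
  for H :: "('f::rc_field, 'h::banach) inner_structure"
    and K :: "('f, 'k::banach) inner_structure" +
  fixes T :: "'h \<Rightarrow> 'k" and V :: "'h set" and a :: real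
  assumes T: "bounded_operator H K T"
    and V: "closed V" "H.VS.subspace V"
    and T_orth: "\<And>x. (\<And>v. v \<in> V \<Longrightarrow> hinner H x v = 0) \<Longrightarrow> T x = 0"
    and a: "0 < a" and bounded_below: "\<And>x. x \<in> V \<Longrightarrow> a * norm x \<le> norm (T x)"
begin

sublocale T: bounded_linear T
  using T by (simp add: bounded_operator_def)

abbreviation "T' \<equiv> adj H K T"
abbreviation "P \<equiv> orth_proj H V"

lemma adj: "hinner K (T x) y = hinner H x (T' y)"
  by (rule adj_works) (fact H.hilbert_space_axioms K.hilbert_space_axioms T)+

lemma T_proj: "T (P x) = T x"
  using T_orth[OF H.orth_proj_orthogonal[OF V], of x] by (simp add: T.diff)

text \<open>The component \<open>r\<close> of \<open>T' y\<close> off \<open>V\<close> is killed by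
  \<open>T\<close>, so it is orthogonal to \<open>T' y\<close>; being orthogonal to \<open>V\<close>
  as well, it is orthogonal to itself.\<close>

lemma adj_in: "T' y \<in> V"
proof -
  define r where "r = T' y - P (T' y)"
  have "hinner H r (T' y) = 0"
    using T_proj[of "T' y"] by (simp add: adj[symmetric] r_def T.diff)
  moreover have "hinner H r (P (T' y)) = 0"
    unfolding r_def by (rule H.orth_proj_orthogonal[OF V H.orth_proj_in[OF V]])
  ultimately have "hinner H r r = 0" by (simp add: r_def H.inner_diff_right)
  then have "T' y = P (T' y)" by (simp add: r_def)
  then show ?thesis using H.orth_proj_in[OF V] by metis
qed

lemma adj_diff: "T' (x - y) = T' x - T' y"
  by (rule H.eq_if_inner_eq)
    (simp add: adj[symmetric] K.inner_diff_right H.inner_diff_right)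

section \<open>The frame operator on \<open>V\<close>\<close>

lemma norm_adj_le:
  assumes "\<And>x. norm (T x) \<le> M * norm x" "0 \<le> M"
  shows "norm (T' y) \<le> M * norm y"
proof (cases "T' y = 0")
  case False
  have "(norm (T' y))\<^sup>2 = norm (hinner K (T (T' y)) y)"
    by (simp add: adj H.norm_inner_self)
  also have "\<dots> \<le> norm (T (T' y)) * norm y" by (rule K.Cauchy_Schwarz)
  also have "\<dots> \<le> M * norm (T' y) * norm y" by (intro mult_right_mono assms) simp
  finally show ?thesis using False by (simp add: power2_eq_square mult.commute mult.left_commute)
qed (use assms in simp)

lemma norm_diff_frame_sq:
  "(norm (x - c *\<^sub>R T' (T x)))\<^sup>2
    = (norm x)\<^sup>2 - 2 * c * (norm (T x))\<^sup>2 + c\<^sup>2 * (norm (T' (T x)))\<^sup>2"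
proof -
  let ?S = "T' (T x)"
  have 1: "hinner H x ?S = of_real ((norm (T x))\<^sup>2)" by (simp only: adj[symmetric] K.inner_self)
  then have 2: "hinner H ?S x = of_real ((norm (T x))\<^sup>2)"
    by (metis H.inner_conjg conjg_of_real)
  have "of_real ((norm (x - c *\<^sub>R ?S))\<^sup>2)
      = (of_real ((norm x)\<^sup>2 - c * (norm (T x))\<^sup>2
          - c * ((norm (T x))\<^sup>2 - c * (norm ?S)\<^sup>2)) :: 'f)"
    unfolding H.inner_self[symmetric] of_real_diff of_real_mult H.scale_of_real[symmetric]
    by (simp only: H.inner_diff_left H.inner_diff_right H.inner_scale_left H.inner_scale_right
        conjg_of_real 1 2)
  then show ?thesis by (simp only: of_real_eq_iff) (simp add: power2_eq_square algebra_simps)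
qed

text \<open>For \<open>c = 1 / M\<^sup>2\<close> with \<open>M\<close> a bound of \<open>T\<close>,
  subtracting \<open>c\<close> times the frame operator from the identity gives a contraction of
  \<open>V\<close>, because \<open>T\<close> is bounded below there.\<close>

lemma frame_surj:
  assumes "y \<in> V"
  obtains u where "u \<in> V" "T' (T u) = y"
proof -
  obtain M0 where M0: "\<And>x. norm (T x) \<le> norm x * M0" "M0 > 0" using T.pos_bounded by blast
  \<comment> \<open>\<open>a \<le> M\<close> gives \<open>c * a\<^sup>2 \<le> 1\<close>, so the root
    defining \<open>\<theta>\<close> has a nonnegative argument.\<close>
  define M where "M = max M0 a"
  have M: "0 < M" "a \<le> M" using a by (auto simp: M_def)
  have TM: "norm (T x) \<le> M * norm x" for x
    using M0(1)[of x] mult_left_mono[of M0 M "norm x"] by (simp add: M_def mult.commute)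
  define c where "c = 1 / M\<^sup>2"
  have c: "0 < c" using M by (simp add: c_def)
  define \<theta> where "\<theta> = sqrt (1 - c * a\<^sup>2)"
  have ca: "c * a\<^sup>2 \<le> 1" using M a by (simp add: c_def power_mono)
  have scale: "r *\<^sub>R x \<in> V" if "x \<in> V" for r x
    using H.VS.subspace_scale[OF V(2) that] by (metis H.scale_of_real)
  have contr: "norm (x - c *\<^sub>R T' (T x)) \<le> \<theta> * norm x" if x: "x \<in> V" for x
  proof -
    have "norm (T' (T x)) \<le> M * norm (T x)" using TM M by (intro norm_adj_le) auto
    then have "(norm (T' (T x)))\<^sup>2 \<le> (M * norm (T x))\<^sup>2" by (intro power_mono) auto
    then have "c\<^sup>2 * (norm (T' (T x)))\<^sup>2 \<le> c\<^sup>2 * (M * norm (T x))\<^sup>2"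
      by (intro mult_left_mono) auto
    also have "\<dots> = c * (norm (T x))\<^sup>2"
      using M by (simp add: c_def power_mult_distrib power2_eq_square)
    \<comment> \<open>The quadratic term of the expansion is at most
      \<open>c * (norm (T x))\<^sup>2\<close>, half of the linear term.\<close>
    finally have "(norm (x - c *\<^sub>R T' (T x)))\<^sup>2 \<le> (norm x)\<^sup>2 - c * (norm (T x))\<^sup>2"
      unfolding norm_diff_frame_sq by simp
    also have "\<dots> \<le> (norm x)\<^sup>2 - c * (a * norm x)\<^sup>2"
      using bounded_below[OF x] a c by (simp add: power_mono)
    also have "\<dots> = (\<theta> * norm x)\<^sup>2"
      using ca by (simp add: \<theta>_def power_mult_distrib algebra_simps)
    finally show ?thesis
      by (rule power2_le_imp_le) (use ca in \<open>simp add: \<theta>_def\<close>)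
  qed
  obtain u where "u \<in> V" "c *\<^sub>R T' (T u) = c *\<^sub>R y"
  proof (rule perturbed_identity_surj[of V "\<lambda>x. c *\<^sub>R T' (T x)" \<theta> "c *\<^sub>R y"])
    show "\<theta> < 1" using c a by (simp add: \<theta>_def)
  qed (use V contr assms in \<open>auto simp: H.VS.subspace_add H.VS.subspace_diff T.diff adj_diff adj_in
        scale scaleR_diff_right\<close>)
  then show thesis using c that by simp
qed

text \<open>\<open>T\<close> after this map is the analysis operator of the canonical dual; the form
  with \<open>inv_into\<close> mirrors \<open>canonical_dual\<close>.\<close>

definition dual_vector :: "'h \<Rightarrow> 'h" where
  "dual_vector h = inv_into V (T' \<circ> T) (P h)"

lemma dual_vector_in: "dual_vector h \<in> V"
  and frame_dual_vector: "T' (T (dual_vector h)) = P h"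
proof -
  obtain u where "u \<in> V" "T' (T u) = P h" using frame_surj[OF H.orth_proj_in[OF V]] .
  then have "P h \<in> (T' \<circ> T) ` V" by force
  then show "dual_vector h \<in> V" "T' (T (dual_vector h)) = P h"
    unfolding dual_vector_def
    using inv_into_into[of "P h" "T' \<circ> T" V] f_inv_into_f[of "P h" "T' \<circ> T" V] by auto
qed

text \<open>Weak form of \<open>T' (T u) = P h\<close>: vectors of \<open>V\<close> do not
  distinguish \<open>P h\<close> from \<open>h\<close>. The estimates below use it in place of the
  inverse frame operator.\<close>

lemma inner_dual_vector:
  assumes "z \<in> V"
  shows "hinner K (T z) (T (dual_vector h)) = hinner H z h"
proof -
  have "hinner H z (h - P h) = 0"
    by (rule H.inner_commute_zero[OF H.orth_proj_orthogonal[OF V assms]])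
  then show ?thesis by (simp add: adj frame_dual_vector H.inner_diff_right)
qed

text \<open>Testing the weak equation with \<open>z = dual_vector h\<close> bounds
  \<open>(norm (T z))\<^sup>2\<close> by \<open>norm z * norm h\<close>, and
  \<open>norm z \<le> norm (T z) / a\<close>.\<close>

lemma norm_dual_vector_le:
  shows "norm (T (dual_vector h)) \<le> norm h / a" "norm (dual_vector h) \<le> norm h / a\<^sup>2"
proof -
  let ?u = "dual_vector h"
  have lower: "a * norm ?u \<le> norm (T ?u)" by (rule bounded_below[OF dual_vector_in])
  have "(norm (T ?u))\<^sup>2 = norm (hinner H ?u h)"
    by (simp only: K.norm_inner_self[symmetric] inner_dual_vector[OF dual_vector_in])
  also have "\<dots> \<le> norm ?u * norm h" by (rule H.Cauchy_Schwarz)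
  also have "\<dots> \<le> (norm (T ?u) / a) * norm h"
    using lower a by (intro mult_right_mono) (auto simp: field_simps)
  finally have "norm (T ?u) * norm (T ?u) \<le> norm (T ?u) * (norm h / a)"
    by (simp add: power2_eq_square)
  then show 1: "norm (T ?u) \<le> norm h / a"
    using a by (cases "T ?u = 0") (auto simp del: times_divide_eq_right)
  show "norm ?u \<le> norm h / a\<^sup>2"
    using order_trans[OF lower 1] a by (simp add: field_simps power2_eq_square)
qed

text \<open>
  Estimating \<open>Y y\<close> for \<open>y \<in> W\<close> directly through \<open>P y\<close> would lose a factor \<open>sqrt (1 - \<Delta>\<^sup>2)\<close>; writing
  \<open>y\<close> as the projection of some \<open>x \<in> V\<close> does not.
\<close>

lemma bounded_below_perturbation:
  assumes Y: "bounded_operator H K Y"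
    and W: "closed W" "H.VS.subspace W"
    and Y_orth: "\<And>x. (\<And>v. v \<in> W \<Longrightarrow> hinner H x v = 0) \<Longrightarrow> Y x = 0"
    and close: "\<And>x. norm (T x - Y x) \<le> \<mu> * norm x" and "\<mu> < a"
    and \<Delta>: "\<And>x. x \<in> W \<Longrightarrow> norm (x - P x) \<le> \<Delta> * norm x" "\<Delta> < 1"
  shows "operator_bounded_below H K Y W (a - \<mu>)"
proof unfold_locales
  interpret Y: bounded_linear Y using Y by (simp add: bounded_operator_def)
  let ?Q = "orth_proj H W"
  fix y assume "y \<in> W"
  \<comment> \<open>On \<open>W\<close> the map \<open>?Q \<circ> P\<close> differs from the
    identity by \<open>?Q (x - P x)\<close>, of norm at most \<open>\<Delta> * norm x\<close>, so it
    is onto.\<close>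
  obtain w where "w \<in> W" "?Q (P w) = y"
  proof (rule perturbed_identity_surj[of W "\<lambda>x. ?Q (P x)" \<Delta> y])
    fix x assume x: "x \<in> W"
    have "x - ?Q (P x) = ?Q (x - P x)" by (simp add: H.orth_proj_diff W H.orth_proj_id x)
    then show "norm (x - ?Q (P x)) \<le> \<Delta> * norm x"
      using H.norm_orth_proj_le(1)[OF W, of "x - P x"] \<Delta>(1)[OF x] by simp
  qed (use W \<open>\<Delta> < 1\<close> \<open>y \<in> W\<close> in \<open>auto simp: H.VS.subspace_add H.VS.subspace_diff H.orth_proj_in
      H.orth_proj_diff V\<close>)
  define x where "x = P w"
  have x: "x \<in> V" "?Q x = y" using H.orth_proj_in[OF V] \<open>?Q (P w) = y\<close> by (auto simp: x_def)
  \<comment> \<open>As a projection of \<open>x\<close>, \<open>y\<close> is no longer than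
    \<open>x\<close>, and \<open>Y\<close> kills \<open>x - y\<close>; the bound known on
    \<open>V\<close> thus passes to \<open>y\<close>.\<close>
  have "(a - \<mu>) * norm y \<le> (a - \<mu>) * norm x"
    using H.norm_orth_proj_le(1)[OF W, of x] x \<open>\<mu> < a\<close> by (intro mult_left_mono) auto
  also have "\<dots> \<le> norm (Y x)"
    using bounded_below[OF x(1)] close[of x] norm_triangle_ineq2[of "T x" "Y x"]
    by (simp add: algebra_simps)
  also have "Y x = Y y"
    using Y_orth[OF H.orth_proj_orthogonal[OF W], of x] x by (simp add: Y.diff)
  finally show "(a - \<mu>) * norm y \<le> norm (Y y)" .
qed (use assms in auto)

end

text \<open>The difference is split at \<open>Y t\<close>: the part \<open>X u - Y t\<close>
  orthogonal to the range of \<open>Y\<close> yields \<open>\<mu> / a\<^sup>2\<close>, and the part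
  \<open>Y (t - v)\<close> inside that range yields the other summand.\<close>

lemma dual_difference_bound:
  assumes X: "operator_bounded_below H K X V a" and Y: "operator_bounded_below H K Y W b"
    and close: "\<And>x. norm (X x - Y x) \<le> \<mu> * norm x" and "0 \<le> \<mu>"
    and \<Delta>: "\<And>x. x \<in> W \<Longrightarrow> norm (x - orth_proj H V x) \<le> \<Delta> * norm x" "0 \<le> \<Delta>"
  shows "norm (X (operator_bounded_below.dual_vector H K X V h)
      - Y (operator_bounded_below.dual_vector H K Y W h))
    \<le> (\<mu> / a\<^sup>2 + (\<mu> / a + \<Delta>) / b) * norm h"
proof -
  interpret X: operator_bounded_below H K X V a by fact
  interpret Y: operator_bounded_below H K Y W b by fact
  define u where "u = X.dual_vector h"
  define v where "v = Y.dual_vector h"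
  note a = X.a and b = Y.a
  obtain t where t: "t \<in> W" "Y.T' (Y t) = Y.T' (X u)" using Y.frame_surj[OF Y.adj_in] by blast
  \<comment> \<open>\<open>Y t\<close> is the orthogonal projection of \<open>X u\<close> onto the range of \<open>Y\<close>.\<close>
  have orth: "hinner K (Y z) (X u - Y t) = 0" for z
    by (simp add: X.K.inner_diff_right Y.adj t)
  have "(norm (X u - Y u))\<^sup>2 = (norm (Y (t - u)))\<^sup>2 + (norm (X u - Y t))\<^sup>2"
    using X.K.pythagoras[OF orth, of "t - u"] by (simp add: Y.T.diff)
  then have "norm (X u - Y t) \<le> norm (X u - Y u)" by (intro power2_le_imp_le[OF _ norm_ge_zero]) simp
  also have "\<dots> \<le> \<mu> * norm u" by (rule close)
  also have "\<dots> \<le> \<mu> * (norm h / a\<^sup>2)"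
    unfolding u_def by (intro mult_left_mono X.norm_dual_vector_le \<open>0 \<le> \<mu>\<close>)
  finally have 1: "norm (X u - Y t) \<le> \<mu> / a\<^sup>2 * norm h" by simp
  define z where "z = t - v"
  have z: "z \<in> W"
    unfolding z_def v_def by (intro X.H.VS.subspace_diff Y.V t Y.dual_vector_in)
  have "hinner K (Y z) (Y z) = hinner K (Y z) (Y t) - hinner K (Y z) (Y v)"
    by (simp add: z_def Y.T.diff X.K.inner_diff_right)
  also have "hinner K (Y z) (Y t) = hinner K (Y z) (X u)"
    using orth[of z] by (simp add: X.K.inner_diff_right)
  also have "hinner K (Y z) (Y v) = hinner H z h"
    unfolding v_def by (rule Y.inner_dual_vector[OF z])
  \<comment> \<open>\<open>z\<close> lies in \<open>W\<close>, whereas the weak equation for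
    \<open>u\<close> holds on \<open>V\<close>. Since \<open>X z = X (P z)\<close>, one may test
    with \<open>P z\<close>, at the cost of \<open>z - P z\<close>.\<close>
  also have "hinner K (Y z) (X u) = hinner K (X (X.P z)) (X u) - hinner K (X z - Y z) (X u)"
    by (simp add: X.T_proj X.K.inner_diff_left)
  also have "hinner K (X (X.P z)) (X u) = hinner H (X.P z) h"
    unfolding u_def by (rule X.inner_dual_vector[OF X.H.orth_proj_in[OF X.V]])
  finally have "hinner K (Y z) (Y z) = - (hinner K (X z - Y z) (X u) + hinner H (z - X.P z) h)"
    by (simp add: X.H.inner_diff_left)
  then have "(norm (Y z))\<^sup>2 = norm (hinner K (X z - Y z) (X u) + hinner H (z - X.P z) h)"
    by (metis X.K.norm_inner_self norm_minus_cancel)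
  also have "\<dots> \<le> norm (X z - Y z) * norm (X u) + norm (z - X.P z) * norm h"
    using X.K.Cauchy_Schwarz X.H.Cauchy_Schwarz by (intro order_trans[OF norm_triangle_ineq] add_mono)
  also have "\<dots> \<le> (\<mu> * norm z) * (norm h / a) + (\<Delta> * norm z) * norm h"
    unfolding u_def using \<open>0 \<le> \<mu>\<close> \<Delta>(1)[OF z] \<Delta>(2) close
    by (intro add_mono mult_mono X.norm_dual_vector_le) auto
  also have "\<dots> = (\<mu> / a + \<Delta>) * norm h * norm z" by (simp add: field_simps)
  also have "\<dots> \<le> (\<mu> / a + \<Delta>) * norm h * (norm (Y z) / b)"
    using Y.bounded_below[OF z] a b \<open>0 \<le> \<mu>\<close> \<open>0 \<le> \<Delta>\<close>
    by (intro mult_left_mono) (auto simp: field_simps)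
  finally have "norm (Y z) * norm (Y z) \<le> norm (Y z) * ((\<mu> / a + \<Delta>) / b * norm h)"
    by (simp add: power2_eq_square mult_ac)
  then have 2: "norm (Y z) \<le> (\<mu> / a + \<Delta>) / b * norm h"
    using a b \<open>0 \<le> \<mu>\<close> \<open>0 \<le> \<Delta>\<close> by (cases "Y z = 0") (auto simp del: times_divide_eq_right)
  have "X u - Y v = (X u - Y t) + Y z" by (simp add: z_def Y.T.diff)
  then have "norm (X u - Y v) \<le> norm (X u - Y t) + norm (Y z)"
    by (metis norm_triangle_ineq)
  with 1 2 show ?thesis by (simp add: u_def v_def distrib_right)
qed

section \<open>Analysis operators\<close>

lemma range_space_closed_subspace:
  assumes "hilbert_space H"
  shows "closed (range_space H K I A)" "module.subspace (hscale H) (range_space H K I A)"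
proof -
  interpret hilbert_space H by fact
  show "closed (range_space H K I A)" "VS.subspace (range_space H K I A)"
    unfolding range_space_def by (auto intro: subspace_closure VS.subspace_span)
qed

section \<open>The analysis operator of a single Bessel sequence\<close>

context
  fixes H :: "('f::rc_field, 'h::banach) inner_structure"
    and K :: "('f, 'k::banach) inner_structure"
    and I :: "nat set" and A :: "nat \<Rightarrow> 'h \<Rightarrow> 'k"
  assumes H: "hilbert_space H" and K: "hilbert_space K" and A: "bessel_sequence H K I A"
begin

lemma bessel_summable: "(\<lambda>i. (norm (A i x))\<^sup>2) summable_on I"
  using A by (auto simp: bessel_sequence_def)

text \<open>The Bessel condition makes the sequence square-summable, so \<open>Abs_ell2\<close> is
  applied where it has its intended value.\<close>

lemma ell2_nth_analysis_op: "ell2_nth (analysis_op I A x) i = (if i \<in> I then A i x else 0)"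
proof -
  have "(\<lambda>i. (norm (if i \<in> I then A i x else 0))\<^sup>2) summable_on UNIV
      \<longleftrightarrow> (\<lambda>i. (norm (A i x))\<^sup>2) summable_on I"
    by (rule summable_on_cong_neutral) auto
  then show ?thesis
    using bessel_summable[of x] by (simp add: analysis_op_def Abs_ell2_inverse)
qed

lemma norm_analysis_op_sq: "(norm (analysis_op I A x))\<^sup>2 = (\<Sum>\<^sub>\<infinity>i\<in>I. (norm (A i x))\<^sup>2)"
proof -
  have "(norm (analysis_op I A x))\<^sup>2 = (\<Sum>\<^sub>\<infinity>i. (norm (if i \<in> I then A i x else 0))\<^sup>2)"
    unfolding norm_ell2.rep_eq by (simp add: infsum_nonneg ell2_nth_analysis_op)
  also have "\<dots> = (\<Sum>\<^sub>\<infinity>i\<in>I. (norm (A i x))\<^sup>2)"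
    by (rule infsum_cong_neutral) auto
  finally show ?thesis .
qed

lemma bounded_operator_analysis_op: "bounded_operator H (ell2_structure K) (analysis_op I A)"
proof -
  interpret K: hilbert_space K by (rule K)
  have bl: "bounded_linear (A i)" and sc: "A i (hscale H c x) = hscale K c (A i x)" if "i \<in> I" for i c x
    using A that by (auto simp: bessel_sequence_def bounded_operator_def)
  obtain \<beta> where \<beta>: "\<beta> > 0" "\<And>x. (\<Sum>\<^sub>\<infinity>i\<in>I. (norm (A i x))\<^sup>2) \<le> \<beta> * (norm x)\<^sup>2"
    using A by (auto simp: bessel_sequence_def)
  have "bounded_linear (analysis_op I A)"
  proof (rule bounded_linear_intro[where K = "sqrt \<beta>"])
    show "analysis_op I A (x + y) = analysis_op I A x + analysis_op I A y"
      "analysis_op I A (r *\<^sub>R x) = r *\<^sub>R analysis_op I A x" for x y r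
      by (auto simp: ell2_nth_inject[symmetric] fun_eq_iff ell2_nth_analysis_op plus_ell2.rep_eq
          scaleR_ell2.rep_eq bounded_linear.linear[OF bl] linear_add linear_scale)
    show "norm (analysis_op I A x) \<le> norm x * sqrt \<beta>" for x
      by (rule power2_le_imp_le)
        (use \<beta> in \<open>auto simp: norm_analysis_op_sq power_mult_distrib mult.commute\<close>)
  qed
  moreover have "analysis_op I A (hscale H c x) = hscale (ell2_structure K) c (analysis_op I A x)" for c x
  proof -
    have "(\<lambda>i. if i \<in> I then A i (hscale H c x) else 0)
        = (\<lambda>i. hscale K c (ell2_nth (analysis_op I A x) i))"
      by (auto simp: ell2_nth_analysis_op sc K.VS.scale_zero_right)
    then show ?thesis by (simp add: ell2_structure_def analysis_op_def)
  qed
  ultimately show ?thesis by (simp add: bounded_operator_def)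
qed

text \<open>The range space contains every \<open>adj H K (A i) y\<close>, so each
  \<open>A i x\<close> is orthogonal to all \<open>y\<close>, itself included.\<close>

lemma analysis_op_orthogonal:
  assumes "\<And>v. v \<in> range_space H K I A \<Longrightarrow> hinner H x v = 0"
  shows "analysis_op I A x = 0"
proof -
  interpret H: hilbert_space H by (rule H)
  interpret K: hilbert_space K by (rule K)
  have "A i x = 0" if i: "i \<in> I" for i
  proof -
    have "adj H K (A i) y \<in> range_space H K I A" for y
      unfolding range_space_def using i
      by (intro subsetD[OF closure_subset] H.VS.span_base) auto
    moreover have "bounded_operator H K (A i)" using A i by (simp add: bessel_sequence_def)
    ultimately have "hinner K (A i x) y = 0" for y
      using assms adj_works[OF H K] by metis
    then show ?thesis using K.inner_self_eq_zero by blast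
  qed
  then show ?thesis
    by (auto simp: ell2_nth_inject[symmetric] fun_eq_iff ell2_nth_analysis_op zero_ell2.rep_eq)
qed

lemma operator_bounded_below_analysis_op:
  assumes "frame_sequence_bounds H K I A \<alpha> \<beta>"
  shows "operator_bounded_below H (ell2_structure K) (analysis_op I A) (range_space H K I A) (sqrt \<alpha>)"
proof -
  interpret H: hilbert_space H by (rule H)
  interpret L: hilbert_space "ell2_structure K" by (rule hilbert_space_ell2[OF K])
  show ?thesis
  proof
    fix x assume "x \<in> range_space H K I A"
    then have "\<alpha> * (norm x)\<^sup>2 \<le> (norm (analysis_op I A x))\<^sup>2" "0 < \<alpha>"
      using assms by (auto simp: frame_sequence_bounds_def norm_analysis_op_sq)
    then show "sqrt \<alpha> * norm x \<le> norm (analysis_op I A x)"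
      by (intro power2_le_imp_le[OF _ norm_ge_zero]) (simp add: power_mult_distrib)
  next
    show "0 < sqrt \<alpha>" using assms by (simp add: frame_sequence_bounds_def)
  qed (fact bounded_operator_analysis_op range_space_closed_subspace[OF H] analysis_op_orthogonal)+
qed

text \<open>Here \<open>b\<^sup>2\<close> serves as lower frame bound and the Bessel constant as
  upper one.\<close>

lemma frame_sequence_if_bounded_below:
  assumes "operator_bounded_below H (ell2_structure K) (analysis_op I A) (range_space H K I A) b"
  shows "frame_sequence H K I A"
proof -
  interpret operator_bounded_below H "ell2_structure K" "analysis_op I A" "range_space H K I A" b
    by fact
  obtain \<beta> where \<beta>: "\<beta> > 0" "\<And>x. (\<Sum>\<^sub>\<infinity>i\<in>I. (norm (A i x))\<^sup>2) \<le> \<beta> * (norm x)\<^sup>2"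
    using A by (auto simp: bessel_sequence_def)
  have "b\<^sup>2 * (norm x)\<^sup>2 \<le> (\<Sum>\<^sub>\<infinity>i\<in>I. (norm (A i x))\<^sup>2)" if "x \<in> range_space H K I A" for x
    unfolding norm_analysis_op_sq[symmetric] power_mult_distrib[symmetric]
    using bounded_below[OF that] a by (intro power_mono) auto
  moreover have "\<forall>i\<in>I. bounded_operator H K (A i)" using A by (simp add: bessel_sequence_def)
  ultimately have "frame_sequence_bounds H K I A (b\<^sup>2) \<beta>"
    unfolding frame_sequence_bounds_def using a \<beta> bessel_summable by auto
  then show ?thesis unfolding frame_sequence_def by blast
qed

text \<open>After unfolding, both sides apply \<open>Abs_ell2\<close> to the same sequence.\<close>

lemma analysis_op_canonical_dual:
  assumes "operator_bounded_below H (ell2_structure K) (analysis_op I A) (range_space H K I A) b"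
  shows "analysis_op I (canonical_dual H K I A) x
    = analysis_op I A (operator_bounded_below.dual_vector H (ell2_structure K) (analysis_op I A)
        (range_space H K I A) x)"
  unfolding operator_bounded_below.dual_vector_def[OF assms]
  by (simp add: analysis_op_def canonical_dual_def frame_op_def fun_eq_iff cong: if_cong)

end

theorem theorem4p9:
  fixes H :: "('f::rc_field, 'h::banach) inner_structure"
    and K :: "('f, 'k::banach) inner_structure"
    and I :: "nat set"
    and A B :: "nat \<Rightarrow> 'h \<Rightarrow> 'k"
    and \<alpha> \<mu> \<Delta> :: real
  assumes "hilbert_space H" and "hilbert_space K"
    and "\<exists>\<beta>. frame_sequence_bounds H K I A \<alpha> \<beta>"
    and "0 < \<mu>" and "\<mu> < sqrt \<alpha>"
    and "perturbation H K I \<mu> A B"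
    and "\<Delta> = gap H (range_space H K I A) (range_space H K I B)"
    and "\<Delta> < 1"
  shows "frame_sequence H K I B \<and>
    onorm (\<lambda>x. analysis_op I (canonical_dual H K I A) x - analysis_op I (canonical_dual H K I B) x)
      \<le> (2 * \<mu> + (2 * sqrt \<alpha> - \<mu>) * \<Delta>) / (sqrt \<alpha> * (sqrt \<alpha> - \<mu>))"
proof -
  interpret H: hilbert_space H by fact
  note HK = assms(1,2)
  let ?V = "range_space H K I A" and ?W = "range_space H K I B"
  let ?X = "analysis_op I A" and ?Y = "analysis_op I B" and ?L = "ell2_structure K"
  define a where "a = sqrt \<alpha>"
  define b where "b = a - \<mu>"
  have A: "bessel_sequence H K I A" and B: "bessel_sequence H K I B"
    and le: "onorm (\<lambda>x. ?X x - ?Y x) \<le> \<mu>"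
    using assms(6) by (auto simp: perturbation_def)
  have opA: "bounded_operator H ?L ?X" and opB: "bounded_operator H ?L ?Y"
    by (rule bounded_operator_analysis_op[OF HK A] bounded_operator_analysis_op[OF HK B])+
  then have "bounded_linear (\<lambda>x. ?X x - ?Y x)"
    by (simp add: bounded_operator_def bounded_linear_sub)
  then have close: "norm (?X x - ?Y x) \<le> \<mu> * norm x" for x
    using onorm[of "\<lambda>x. ?X x - ?Y x" x] mult_right_mono[OF le, of "norm x"] by simp
  note V = range_space_closed_subspace[OF HK(1), of K I A]
  note W = range_space_closed_subspace[OF HK(1), of K I B]
  \<comment> \<open>Of the two one-sided gaps, the one from \<open>?W\<close> to \<open>?V\<close>
    drives both the lower bound for \<open>?Y\<close> and the estimate of the duals.\<close>
  have delta_le: "delta H ?W ?V \<le> \<Delta>" using assms(7) by (simp add: gap_def)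
  have \<Delta>: "norm (x - orth_proj H ?V x) \<le> \<Delta> * norm x" if "x \<in> ?W" for x
    using H.norm_diff_orth_proj_le_delta[OF V that] mult_right_mono[OF delta_le, of "norm x"]
    by simp
  have \<Delta>0: "0 \<le> \<Delta>" using H.delta_nonneg[OF V H.VS.subspace_0[OF W(2)]] delta_le by simp
  obtain \<beta> where "frame_sequence_bounds H K I A \<alpha> \<beta>" using assms(3) by blast
  then have X: "operator_bounded_below H ?L ?X ?V a"
    unfolding a_def by (rule operator_bounded_below_analysis_op[OF HK A])
  then have Y: "operator_bounded_below H ?L ?Y ?W b"
    unfolding b_def using assms(5,8) \<Delta> close
    by (intro operator_bounded_below.bounded_below_perturbation[OF X opB W
          analysis_op_orthogonal[OF HK B]]) (auto simp: a_def)
  have ab: "0 < b" "b < a" using assms(4,5) by (auto simp: a_def b_def)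
  \<comment> \<open>Enlarging \<open>\<mu> / a\<^sup>2\<close> to \<open>\<mu> / (a * b)\<close> and
    adding \<open>\<Delta> / a\<close> gives the common denominator \<open>a * b\<close>; the
    claimed form follows from \<open>a + b = 2 * sqrt \<alpha> - \<mu>\<close>.\<close>
  have "\<mu> / a\<^sup>2 + (\<mu> / a + \<Delta>) / b \<le> \<mu> / (a * b) + (\<mu> / a + \<Delta>) / b + \<Delta> / a"
  proof -
    have "\<mu> / a\<^sup>2 \<le> \<mu> / (a * b)"
      using ab assms(4) by (intro divide_left_mono) (auto simp: power2_eq_square)
    moreover have "0 \<le> \<Delta> / a" using ab \<Delta>0 by simp
    ultimately show ?thesis by linarith
  qed
  also have "\<dots> = (2 * \<mu> + (a + b) * \<Delta>) / (a * b)"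
    using ab by (simp add: field_simps)
  finally have bound: "\<mu> / a\<^sup>2 + (\<mu> / a + \<Delta>) / b \<le> (2 * \<mu> + (a + b) * \<Delta>) / (a * b)" .
  have "onorm (\<lambda>x. analysis_op I (canonical_dual H K I A) x - analysis_op I (canonical_dual H K I B) x)
      \<le> (2 * \<mu> + (a + b) * \<Delta>) / (a * b)"
  proof (rule onorm_bound)
    show "0 \<le> (2 * \<mu> + (a + b) * \<Delta>) / (a * b)" using ab assms(4) \<Delta>0 by simp
  next
    fix h
    have "norm (analysis_op I (canonical_dual H K I A) h - analysis_op I (canonical_dual H K I B) h)
        \<le> (\<mu> / a\<^sup>2 + (\<mu> / a + \<Delta>) / b) * norm h"
      unfolding analysis_op_canonical_dual[OF HK A X] analysis_op_canonical_dual[OF HK B Y]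
      using dual_difference_bound[OF X Y close _ \<Delta> \<Delta>0] assms(4) by simp
    also have "\<dots> \<le> (2 * \<mu> + (a + b) * \<Delta>) / (a * b) * norm h"
      by (rule mult_right_mono[OF bound]) simp
    finally show "norm (analysis_op I (canonical_dual H K I A) h
        - analysis_op I (canonical_dual H K I B) h) \<le> (2 * \<mu> + (a + b) * \<Delta>) / (a * b) * norm h" .
  qed
  moreover have "a + b = 2 * sqrt \<alpha> - \<mu>" by (simp add: a_def b_def)
  ultimately show ?thesis
    using frame_sequence_if_bounded_below[OF HK B Y] by (simp add: a_def b_def)
qed

end
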